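(* Let $A$ be a commutative unital $\mathbb{R}$-algebra, let $\rho$ be a submultiplicative seminorm on $A$, let $d\ge 1$ be an integer, and let $S$ be a $\sum A^{2d}$-module of $A$. Then the closure $\overline{S}^{\rho}$ of $S$ in the topology induced by $\rho$ satisfies $$\overline{S}^{\rho}=\mathrm{Pos}(\mathcal{K}_S\cap \mathfrak{sp}(\rho)).$$ In particular, $\overline{\sum A^{2d}}^{\rho}=\mathrm{Pos}(\mathfrak{sp}(\rho))$.
   Context: A seminorm on $A$ is a map $\rho:A\to[0,\infty)$ with $\rho(rx)=|r|\rho(x)$ and $\rho(x+y)\le\rho(x)+\rho(y)$ for $r\in\mathbb{R}$, $x,y\in A$; it is submultiplicative if also $\rho(xy)\le\rho(x)\rho(y)$ for all $x,y\in A$. $\mathcal{X}(A)$ denotes the set of all unital $\mathbb{R}$-algebra homomorphisms $A\to\mathbb{R}$, and for $a\in A$, $\hat a:\mathcal{X}(A)\to\mathbb{R}$ is $\hat a(\alpha)=\alpha(a)$. $\mathfrak{sp}(\rho)$ denotes the set of all $\rho$-continuous $\alpha\in\mathcal{X}(A)$. $\sum A^{2d}$ is the set of all finite sums of $2d$-th powers of elements of $A$. A $\sum A^{2d}$-module of $A$ is a subset $S\subseteq A$ with $1\in S$, $S+S\subseteq S$ and $a^{2d}\cdot S\subseteq S$ for every $a\in A$. For $S\subseteq A$, $\mathcal{K}_S:=\{\alpha\in\mathcal{X}(A): \hat a(\alpha)\ge 0\text{ for all }a\in S\}$. For $K\subseteq\mathcal{X}(A)$, $\mathrm{Pos}(K):=\{a\in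 A:\hat a(\alpha)\ge 0\text{ for all }\alpha\in K\}$. *)

theory Defs
  imports "HOL-Analysis.Analysis"
begin

(* Commutative unital real algebras are types of sort {real_algebra, comm_ring, comm_monoid_mult}.
   Unlike {real_algebra_1, comm_ring_1}, this sort does not impose 0 \<noteq> 1, so that the zero
   algebra is included. *)

definition seminorm :: "('a::real_vector \<Rightarrow> real) \<Rightarrow> bool" where
  "seminorm \<rho> \<longleftrightarrow>
     (\<forall>x. 0 \<le> \<rho> x) \<and>
     (\<forall>r x. \<rho> (r *\<^sub>R x) = \<bar>r\<bar> * \<rho> x) \<and>
     (\<forall>x y. \<rho> (x + y) \<le> \<rho> x + \<rho> y)"

definition submultiplicative_seminorm :: "('a::real_algebra \<Rightarrow> real) \<Rightarrow> bool" where
  "submultiplicative_seminorm \<rho> \<longleftrightarrow> seminorm \<rho> \<and> (\<forall>x y. \<rho> (x * y) \<le> \<rho> x * \<rho> y)"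

(* In general not Hausdorff, since \<rho> may vanish at nonzero elements; hence not an instance of
   the library's metric topologies. *)
definition seminorm_topology :: "('a::real_vector \<Rightarrow> real) \<Rightarrow> 'a topology" where
  "seminorm_topology \<rho> = topology_generated_by {{y. \<rho> (y - x) < e} | x e. 0 < e}"

definition characters :: "('a::{real_algebra, comm_ring, comm_monoid_mult} \<Rightarrow> real) set" where
  "characters = {\<alpha>. linear \<alpha> \<and> \<alpha> 1 = 1 \<and> (\<forall>x y. \<alpha> (x * y) = \<alpha> x * \<alpha> y)}"

definition gelfand_spectrum ::
    "('a::{real_algebra, comm_ring, comm_monoid_mult} \<Rightarrow> real) \<Rightarrow> ('a \<Rightarrow> real) set" where
  "gelfand_spectrum \<rho> = {\<alpha> \<in> characters. continuous_map (seminorm_topology \<rho>) euclideanreal \<alpha>}"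

definition sums_of_powers :: "nat \<Rightarrow> 'a::{real_algebra, comm_ring, comm_monoid_mult} set" where
  "sums_of_powers k = {\<Sum>i<n. a i ^ k | (n::nat) a. True}"

definition power_module ::
    "nat \<Rightarrow> 'a::{real_algebra, comm_ring, comm_monoid_mult} set \<Rightarrow> bool" where
  "power_module k S \<longleftrightarrow>
     1 \<in> S \<and> (\<forall>x\<in>S. \<forall>y\<in>S. x + y \<in> S) \<and> (\<forall>a. \<forall>x\<in>S. a ^ k * x \<in> S)"

definition nonneg_characters ::
    "'a::{real_algebra, comm_ring, comm_monoid_mult} set \<Rightarrow> ('a \<Rightarrow> real) set" where
  "nonneg_characters S = {\<alpha> \<in> characters. \<forall>a\<in>S. 0 \<le> \<alpha> a}"

definition Pos :: "('a \<Rightarrow> real) set \<Rightarrow> 'a set" where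
  "Pos K = {a. \<forall>\<alpha>\<in>K. 0 \<le> \<alpha> a}"

end

theory Submission
  imports Defs
begin

text \<open>
  A \<open>\<rho>\<close>-continuous character that is nonnegative on \<open>S\<close> is nonnegative on the closure \<open>C\<close> of \<open>S\<close>.
  The content of the theorem is the converse: every \<open>a \<notin> C\<close> is negative at some such character.
  The statement about sums of powers is the special case in which, the exponent being even, every
  character is nonnegative on \<open>S\<close>.

  The powers \<open>a ^ k\<close>, with \<open>k = 2 * d\<close>, enter this converse in one place. If \<open>\<rho> z < r\<close>, then \<open>r + z\<close> is a \<open>\<rho>\<close>-limit of
  \<open>k\<close>-th powers, namely of the \<open>k\<close>-th powers of the partial sums of the binomial series
  for the \<open>k\<close>-th root (\<open>approx_root\<close>). Hence \<open>C\<close> is stable under multiplication by all these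
  elements (\<open>ball_module_closure_of_power_module\<close>). Call a subset that contains \<open>1\<close> and is stable under
  addition and under these multiplications a ball module. A ball module is a convex cone for which \<open>1\<close>
  is an order unit, because it contains \<open>r + z\<close> whenever \<open>\<rho> z < r\<close>. From here on the argument is
  order-theoretic.

  The main step is \<open>ball_module_extend\<close>: if \<open>x\<close> belongs to a ball module \<open>M\<close>, but no
  \<open>x - e\<close> with \<open>e > 0\<close> does, then \<open>- x\<close> can be adjoined without creating \<open>- 1\<close>. In terms of states, that
  is, of normalised functionals nonnegative on \<open>M\<close>, such an \<open>x\<close> has minimum \<open>0\<close>, and adjoining \<open>- x\<close>
  passes to the face where the minimum is attained.

  In a ball module \<open>M\<close> that is maximal subject to \<open>- 1 \<notin> M\<close>, the step applies to \<open>x - m\<close>, where \<open>m\<close> is the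
  largest constant with \<open>x - m \<in> M\<close>. So every \<open>x\<close> is congruent to a constant modulo \<open>M \<inter> - M\<close>.
  This intersection is an ideal, because the elements \<open>r + z\<close> span the algebra. The
  quotient is therefore the real line, and the quotient map is a character
  (\<open>character_of_maximal_ball_module\<close>). It is nonnegative on \<open>M\<close> and bounded by \<open>\<rho>\<close>.

  To separate \<open>a\<close> from \<open>C\<close>, let \<open>m\<close> be the largest constant with \<open>a - m \<in> C\<close>. It is negative because
  \<open>a \<notin> C\<close>. Adjoining \<open>m - a\<close> to \<open>C\<close> before passing to a maximal module forces
  the character to take the value \<open>m\<close> at \<open>a\<close>.
\<close>

section \<open>Partial sums of power series\<close>

definition fps_partial_eval ::
    "real fps \<Rightarrow> 'a::{real_algebra, comm_ring, comm_monoid_mult} \<Rightarrow> nat \<Rightarrow> 'a" where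
  "fps_partial_eval F x N = (\<Sum>n\<le>N. fps_nth F n *\<^sub>R x ^ n)"

text \<open>The product of two partial sums consists of the terms indexed by a square; the partial sum of
  the product takes only those in the triangle below the diagonal \<open>i + j = N\<close>.\<close>

lemma fps_partial_eval_mult_diff:
  "fps_partial_eval F x N * fps_partial_eval G x N - fps_partial_eval (F * G) x N =
   (\<Sum>(i, j)\<in>{..N} \<times> {..N} - {(i, j). i + j \<le> N}. (fps_nth F i * fps_nth G j) *\<^sub>R x ^ (i + j))"
proof -
  let ?t = "\<lambda>i j. (fps_nth F i * fps_nth G j) *\<^sub>R x ^ (i + j)"
  have "fps_partial_eval F x N * fps_partial_eval G x N = (\<Sum>(i, j)\<in>{..N} \<times> {..N}. ?t i j)"
    by (simp add: fps_partial_eval_def sum_product sum.cartesian_product power_add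
        mult.commute)
  moreover have "fps_partial_eval (F * G) x N = (\<Sum>k\<le>N. \<Sum>i\<le>k. ?t i (k - i))"
    by (simp add: fps_partial_eval_def fps_mult_nth scaleR_sum_left atLeast0AtMost)
  moreover have "\<dots> = (\<Sum>(i, j)\<in>{(i, j). i + j \<le> N}. ?t i j)"
    by (rule sum.triangle_reindex_eq[symmetric])
  moreover have "{(i, j). i + j \<le> N} \<subseteq> {..N} \<times> {..N}" by auto
  ultimately show ?thesis
    by (simp add: sum_diff)
qed

text \<open>Over the reals, with the absolute values as coefficients, the sum over the remaining half of the
  square is itself the difference between a product of partial sums and a partial sum of the Cauchy
  product; both have the same limit. This bounds the error in any seminormed algebra.\<close>

lemma fps_partial_eval_abs_mult_diff_tendsto_0:
  fixes R :: real
  assumes F: "summable (\<lambda>n. norm (fps_nth F n * R ^ n))"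
    and G: "summable (\<lambda>n. norm (fps_nth G n * R ^ n))"
    and R: "0 \<le> R"
  shows "(\<lambda>N. \<Sum>(i, j)\<in>{..N} \<times> {..N} - {(i, j). i + j \<le> N}.
            \<bar>fps_nth F i\<bar> * \<bar>fps_nth G j\<bar> * R ^ (i + j)) \<longlonglongrightarrow> 0"
proof -
  define F' G' where "F' = Abs_fps (\<lambda>n. \<bar>fps_nth F n\<bar>)" and "G' = Abs_fps (\<lambda>n. \<bar>fps_nth G n\<bar>)"
  define f g where "f = (\<lambda>n. fps_nth F' n * R ^ n)" and "g = (\<lambda>n. fps_nth G' n * R ^ n)"
  have "norm (f n) = norm (fps_nth F n * R ^ n)" "norm (g n) = norm (fps_nth G n * R ^ n)" for n
    using R by (auto simp: f_def g_def F'_def G'_def abs_mult)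
  with F G have sf: "summable (\<lambda>n. norm (f n))" and sg: "summable (\<lambda>n. norm (g n))"
    by simp_all
  have "(\<lambda>N. fps_partial_eval F' R N) \<longlonglongrightarrow> suminf f" "(\<lambda>N. fps_partial_eval G' R N) \<longlonglongrightarrow> suminf g"
    using summable_LIMSEQ'[OF summable_norm_cancel[OF sf]]
      summable_LIMSEQ'[OF summable_norm_cancel[OF sg]]
    by (simp_all add: f_def g_def fps_partial_eval_def)
  moreover have "(\<lambda>N. fps_partial_eval (F' * G') R N) \<longlonglongrightarrow> suminf f * suminf g"
  proof -
    have "(\<Sum>i\<le>n. f i * g (n - i)) = fps_nth (F' * G') n * R ^ n" for n
    proof -
      have "f i * g (n - i) = fps_nth F' i * fps_nth G' (n - i) * R ^ n" if "i \<le> n" for i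
        using power_add[of R i "n - i"] that by (simp add: f_def g_def mult_ac)
      then show ?thesis
        by (simp add: fps_mult_nth sum_distrib_right atLeast0AtMost)
    qed
    then show ?thesis
      using Cauchy_product_sums[OF sf sg] by (simp add: sums_def_le fps_partial_eval_def)
  qed
  ultimately have "(\<lambda>N. fps_partial_eval F' R N * fps_partial_eval G' R N
      - fps_partial_eval (F' * G') R N) \<longlonglongrightarrow> 0"
    by (auto intro!: tendsto_eq_intros)
  then show ?thesis
    unfolding fps_partial_eval_mult_diff by (simp add: F'_def G'_def)
qed

section \<open>Seminorms and their topology\<close>

context
  fixes \<rho> :: "'a::{real_algebra, comm_ring, comm_monoid_mult} \<Rightarrow> real"
  assumes subm: "submultiplicative_seminorm \<rho>"
begin

lemma seminorm_nonneg: "0 \<le> \<rho> x"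
  and seminorm_scaleR: "\<rho> (r *\<^sub>R x) = \<bar>r\<bar> * \<rho> x"
  and seminorm_add: "\<rho> (x + y) \<le> \<rho> x + \<rho> y"
  and seminorm_mult: "\<rho> (x * y) \<le> \<rho> x * \<rho> y"
  using subm by (auto simp: submultiplicative_seminorm_def seminorm_def)

lemma seminorm_zero: "\<rho> 0 = 0"
  using seminorm_scaleR[of 0 0] by simp

lemma seminorm_minus: "\<rho> (- x) = \<rho> x"
  using seminorm_scaleR[of "-1" x] by simp

lemma seminorm_sum: "\<rho> (sum f I) \<le> (\<Sum>i\<in>I. \<rho> (f i))"
proof (induction I rule: infinite_finite_induct)
  case (insert i I)
  then show ?case
    using seminorm_add[of "f i" "sum f I"] by simp
qed (auto simp: seminorm_zero)

text \<open>The factor \<open>\<rho> 1\<close> covers \<open>n = 0\<close>, since \<open>\<rho> 1\<close> may exceed \<open>1\<close>.\<close>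

lemma seminorm_power: "\<rho> (x ^ n) \<le> \<rho> 1 * \<rho> x ^ n"
proof (induction n)
  case (Suc n)
  have "\<rho> (x ^ Suc n) \<le> \<rho> x * \<rho> (x ^ n)"
    using seminorm_mult by simp
  also have "\<dots> \<le> \<rho> x * (\<rho> 1 * \<rho> x ^ n)"
    by (intro mult_left_mono Suc seminorm_nonneg)
  finally show ?case by (simp add: mult_ac)
qed simp

lemma openin_seminorm_topology:
  "openin (seminorm_topology \<rho>) U \<longleftrightarrow> (\<forall>x\<in>U. \<exists>e>0. \<forall>y. \<rho> (y - x) < e \<longrightarrow> y \<in> U)"
proof
  assume "openin (seminorm_topology \<rho>) U"
  then have "generate_topology_on {{y. \<rho> (y - x) < e} | x e. 0 < e} U"
    by (simp add: seminorm_topology_def openin_topology_generated_by_iff)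
  then show "\<forall>x\<in>U. \<exists>e>0. \<forall>y. \<rho> (y - x) < e \<longrightarrow> y \<in> U"
  proof induction
    case (Int a b)
    show ?case
    proof
      fix x assume "x \<in> a \<inter> b"
      with Int obtain e e' where "e > 0" "\<forall>y. \<rho> (y - x) < e \<longrightarrow> y \<in> a"
        "e' > 0" "\<forall>y. \<rho> (y - x) < e' \<longrightarrow> y \<in> b" by blast
      then show "\<exists>e>0. \<forall>y. \<rho> (y - x) < e \<longrightarrow> y \<in> a \<inter> b"
        by (intro exI[of _ "min e e'"]) auto
    qed
  next
    case (UN K)
    then show ?case by (meson Union_iff)
  next
    case (Basis s)
    then obtain c e where s: "s = {y. \<rho> (y - c) < e}" by auto
    show ?case
    proof
      fix x assume x: "x \<in> s"
      have "y \<in> s" if "\<rho> (y - x) < e - \<rho> (x - c)" for y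
        using seminorm_add[of "y - x" "x - c"] that by (simp add: s)
      then show "\<exists>e>0. \<forall>y. \<rho> (y - x) < e \<longrightarrow> y \<in> s"
        using x by (intro exI[of _ "e - \<rho> (x - c)"]) (auto simp: s)
    qed
  qed auto
next
  assume *: "\<forall>x\<in>U. \<exists>e>0. \<forall>y. \<rho> (y - x) < e \<longrightarrow> y \<in> U"
  show "openin (seminorm_topology \<rho>) U"
  proof (subst openin_subopen, intro ballI)
    fix x assume "x \<in> U"
    with * obtain e where e: "e > 0" "\<forall>y. \<rho> (y - x) < e \<longrightarrow> y \<in> U" by blast
    have "openin (seminorm_topology \<rho>) {y. \<rho> (y - x) < e}"
      unfolding seminorm_topology_def using e by (intro topology_generated_by_Basis) auto
    then show "\<exists>T. openin (seminorm_topology \<rho>) T \<and> x \<in> T \<and> T \<subseteq> U"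
      using e seminorm_zero by (intro exI[of _ "{y. \<rho> (y - x) < e}"]) auto
  qed
qed

lemma topspace_seminorm_topology: "topspace (seminorm_topology \<rho>) = UNIV"
proof -
  have "openin (seminorm_topology \<rho>) UNIV"
    by (auto simp: openin_seminorm_topology intro: exI[of _ 1])
  then show ?thesis
    using openin_subset by blast
qed

lemma in_seminorm_closure_iff:
  "a \<in> seminorm_topology \<rho> closure_of S \<longleftrightarrow> (\<forall>e>0. \<exists>s\<in>S. \<rho> (s - a) < e)"
proof
  assume a: "a \<in> seminorm_topology \<rho> closure_of S"
  show "\<forall>e>0. \<exists>s\<in>S. \<rho> (s - a) < e"
  proof (intro allI impI)
    fix e :: real assume "e > 0"
    then have "openin (seminorm_topology \<rho>) {y. \<rho> (y - a) < e}"
      unfolding seminorm_topology_def by (intro topology_generated_by_Basis) auto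
    moreover have "a \<in> {y. \<rho> (y - a) < e}"
      using \<open>e > 0\<close> by (simp add: seminorm_zero)
    ultimately obtain s where "s \<in> S" "s \<in> {y. \<rho> (y - a) < e}"
      using a unfolding in_closure_of by meson
    then show "\<exists>s\<in>S. \<rho> (s - a) < e" by auto
  qed
next
  assume *: "\<forall>e>0. \<exists>s\<in>S. \<rho> (s - a) < e"
  show "a \<in> seminorm_topology \<rho> closure_of S"
    unfolding in_closure_of topspace_seminorm_topology
  proof (intro conjI allI impI UNIV_I)
    fix U assume U: "a \<in> U \<and> openin (seminorm_topology \<rho>) U"
    from U have "\<exists>e>0. \<forall>y. \<rho> (y - a) < e \<longrightarrow> y \<in> U"
      by (simp add: openin_seminorm_topology)
    with * show "\<exists>y. y \<in> S \<and> y \<in> U" by blast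
  qed
qed

lemma continuous_map_if_bounded:
  assumes "linear \<alpha>" and bd: "\<And>x. \<bar>\<alpha> x\<bar> \<le> \<rho> x"
  shows "continuous_map (seminorm_topology \<rho>) euclideanreal \<alpha>"
  unfolding continuous_map_def topspace_seminorm_topology openin_seminorm_topology
proof (intro conjI allI impI ballI)
  fix U x assume "openin euclideanreal U" and x: "x \<in> {x \<in> UNIV. \<alpha> x \<in> U}"
  then obtain e where e: "e > 0" "\<forall>t. \<bar>t - \<alpha> x\<bar> < e \<longrightarrow> t \<in> U"
    by (auto simp: open_dist dist_real_def)
  have "\<alpha> y \<in> U" if "\<rho> (y - x) < e" for y
    using bd[of "y - x"] that e(2) by (simp add: linear_diff[OF \<open>linear \<alpha>\<close>])
  with e(1) show "\<exists>e>0. \<forall>y. \<rho> (y - x) < e \<longrightarrow> y \<in> {x \<in> UNIV. \<alpha> x \<in> U}"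
    by auto
qed auto

section \<open>Approximate roots of elements near a positive constant\<close>

lemma seminorm_partial_eval_mult_diff_tendsto_0:
  assumes F: "\<rho> x < fps_conv_radius F" and G: "\<rho> x < fps_conv_radius G"
  shows "(\<lambda>N. \<rho> (fps_partial_eval F x N * fps_partial_eval G x N
            - fps_partial_eval (F * G) x N)) \<longlonglongrightarrow> 0"
proof (rule tendsto_sandwich[OF _ _ tendsto_const])
  let ?D = "\<lambda>N. {..N} \<times> {..N} - {(i, j). i + j \<le> N}"
  let ?s = "\<lambda>N. \<Sum>(i, j)\<in>?D N. \<bar>fps_nth F i\<bar> * \<bar>fps_nth G j\<bar> * \<rho> x ^ (i + j)"
  have "?s \<longlonglongrightarrow> 0"
    using F G seminorm_nonneg
    by (intro fps_partial_eval_abs_mult_diff_tendsto_0 norm_summable_fps) auto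
  then show "(\<lambda>N. \<rho> 1 * ?s N) \<longlonglongrightarrow> 0"
    by (auto intro!: tendsto_eq_intros)
  show "\<forall>\<^sub>F N in sequentially. \<rho> (fps_partial_eval F x N * fps_partial_eval G x N
      - fps_partial_eval (F * G) x N) \<le> \<rho> 1 * ?s N"
  proof (rule always_eventually, rule allI)
    fix N
    have "\<rho> ((fps_nth F i * fps_nth G j) *\<^sub>R x ^ (i + j))
        \<le> \<rho> 1 * (\<bar>fps_nth F i\<bar> * \<bar>fps_nth G j\<bar> * \<rho> x ^ (i + j))" for i j
      using mult_left_mono[OF seminorm_power[of x "i + j"], of "\<bar>fps_nth F i * fps_nth G j\<bar>"]
      by (simp add: seminorm_scaleR abs_mult mult_ac)
    then have "(\<Sum>p\<in>?D N. \<rho> (case p of (i, j) \<Rightarrow> (fps_nth F i * fps_nth G j) *\<^sub>R x ^ (i + j)))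
        \<le> \<rho> 1 * ?s N"
      unfolding sum_distrib_left by (intro sum_mono) auto
    then show "\<rho> (fps_partial_eval F x N * fps_partial_eval G x N
      - fps_partial_eval (F * G) x N) \<le> \<rho> 1 * ?s N"
      unfolding fps_partial_eval_mult_diff
      using seminorm_sum order_trans by blast
  qed
qed (simp add: seminorm_nonneg)

lemma seminorm_partial_eval_bounded:
  assumes F: "\<rho> x < fps_conv_radius F"
  shows "\<exists>B. \<forall>N. \<rho> (fps_partial_eval F x N) \<le> B"
proof -
  have sm: "summable (\<lambda>n. norm (fps_nth F n * \<rho> x ^ n))"
    using F seminorm_nonneg by (intro norm_summable_fps) auto
  have "\<rho> (fps_partial_eval F x N) \<le> \<rho> 1 * (\<Sum>n. norm (fps_nth F n * \<rho> x ^ n))" for N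
  proof -
    have "\<rho> (fps_partial_eval F x N) \<le> (\<Sum>n\<le>N. \<rho> (fps_nth F n *\<^sub>R x ^ n))"
      unfolding fps_partial_eval_def by (rule seminorm_sum)
    also have "\<dots> \<le> (\<Sum>n\<le>N. \<rho> 1 * norm (fps_nth F n * \<rho> x ^ n))"
    proof (rule sum_mono)
      fix n
      show "\<rho> (fps_nth F n *\<^sub>R x ^ n) \<le> \<rho> 1 * norm (fps_nth F n * \<rho> x ^ n)"
        using mult_left_mono[OF seminorm_power[of x n], of "\<bar>fps_nth F n\<bar>"] seminorm_nonneg
        by (simp add: seminorm_scaleR abs_mult mult_ac)
    qed
    also have "\<dots> \<le> \<rho> 1 * (\<Sum>n. norm (fps_nth F n * \<rho> x ^ n))"
      unfolding sum_distrib_left[symmetric]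
      by (intro mult_left_mono sum_le_suminf sm seminorm_nonneg) auto
    finally show ?thesis .
  qed
  then show ?thesis by blast
qed

text \<open>A power series evaluated at \<open>x\<close> need not converge in the algebra, which is not assumed complete. Its
  partial sums nevertheless respect powers up to an error that tends to \<open>0\<close>.\<close>

lemma seminorm_partial_eval_power_diff_tendsto_0:
  assumes F: "\<rho> x < fps_conv_radius F"
  shows "(\<lambda>N. \<rho> (fps_partial_eval F x N ^ k - fps_partial_eval (F ^ k) x N)) \<longlonglongrightarrow> 0"
proof (induction k)
  case 0
  have "fps_partial_eval 1 x N = 1" for N
    by (simp add: fps_partial_eval_def if_distrib[of "\<lambda>c. c *\<^sub>R _"] cong: if_cong)
  then show ?case by (simp add: seminorm_zero)
next
  case (Suc k)
  obtain B where B: "\<And>N. \<rho> (fps_partial_eval F x N) \<le> B"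
    using seminorm_partial_eval_bounded[OF F] by blast
  let ?p = "fps_partial_eval F x" and ?q = "fps_partial_eval (F ^ k) x"
  let ?r = "fps_partial_eval (F ^ Suc k) x"
  have "\<rho> x < fps_conv_radius (F ^ k)"
    using F fps_conv_radius_power[of F k] by (rule less_le_trans)
  from seminorm_partial_eval_mult_diff_tendsto_0[OF F this]
  have lim: "(\<lambda>N. B * \<rho> (?p N ^ k - ?q N) + \<rho> (?p N * ?q N - ?r N)) \<longlonglongrightarrow> 0"
    using Suc by (auto intro!: tendsto_eq_intros)
  show ?case
  proof (rule tendsto_sandwich[OF _ _ tendsto_const lim])
    show "\<forall>\<^sub>F N in sequentially. \<rho> (?p N ^ Suc k - ?r N)
        \<le> B * \<rho> (?p N ^ k - ?q N) + \<rho> (?p N * ?q N - ?r N)"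
    proof (rule always_eventually, rule allI)
      fix N
      have "?p N ^ Suc k - ?r N = ?p N * (?p N ^ k - ?q N) + (?p N * ?q N - ?r N)"
        by (simp add: algebra_simps)
      then have "\<rho> (?p N ^ Suc k - ?r N)
          \<le> \<rho> (?p N * (?p N ^ k - ?q N)) + \<rho> (?p N * ?q N - ?r N)"
        by (simp only: seminorm_add)
      also have "\<rho> (?p N * (?p N ^ k - ?q N)) \<le> \<rho> (?p N) * \<rho> (?p N ^ k - ?q N)"
        by (rule seminorm_mult)
      also have "\<rho> (?p N) * \<rho> (?p N ^ k - ?q N) \<le> B * \<rho> (?p N ^ k - ?q N)"
        by (intro mult_right_mono B seminorm_nonneg)
      finally show "\<rho> (?p N ^ Suc k - ?r N)
        \<le> B * \<rho> (?p N ^ k - ?q N) + \<rho> (?p N * ?q N - ?r N)" by simp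
    qed
  qed (simp add: seminorm_nonneg)
qed

text \<open>The binomial series \<open>F\<close> with exponent \<open>1 / k\<close> has radius of convergence at least \<open>1\<close>, and
  \<open>F ^ k = 1 + X\<close> is a polynomial, so its partial sums at \<open>x\<close> are eventually equal to \<open>1 + x\<close>.\<close>

lemma approx_root_one_plus:
  assumes x: "\<rho> x < 1" and k: "0 < k" and e: "0 < e"
  shows "\<exists>p. \<rho> (p ^ k - (1 + x)) < e"
proof -
  define F :: "real fps" where "F = fps_binomial (1 / real k)"
  have Fk: "F ^ k = 1 + fps_X"
    using k by (simp add: F_def fps_binomial_power fps_binomial_1)
  have "1 \<le> fps_conv_radius F"
    by (simp add: F_def fps_conv_radius_def conv_radius_gchoose)
  with x have "\<rho> x < fps_conv_radius F"
    by (smt (verit) ereal_less_le less_le_trans ereal_less(3))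
  from seminorm_partial_eval_power_diff_tendsto_0[OF this, of k]
  have "\<forall>\<^sub>F N in sequentially. \<rho> (fps_partial_eval F x N ^ k - fps_partial_eval (1 + fps_X) x N) < e"
    unfolding Fk using e by (rule order_tendstoD)
  then obtain N where N: "\<forall>n\<ge>N. \<rho> (fps_partial_eval F x n ^ k - fps_partial_eval (1 + fps_X) x n) < e"
    by (auto simp: eventually_sequentially)
  have "fps_partial_eval (1 + fps_X) x (Suc N) = 1 + x"
    by (induction N) (simp_all add: fps_partial_eval_def)
  with N[rule_format, of "Suc N"] show ?thesis by auto
qed

lemma approx_root:
  assumes z: "\<rho> z < r" and k: "0 < k" and e: "0 < e"
  shows "\<exists>p. \<rho> (p ^ k - (r *\<^sub>R 1 + z)) < e"
proof -
  have r: "r > 0"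
    using z seminorm_nonneg[of z] by linarith
  have "\<rho> ((1 / r) *\<^sub>R z) < 1"
    using z r by (simp add: seminorm_scaleR)
  then obtain p where p: "\<rho> (p ^ k - (1 + (1 / r) *\<^sub>R z)) < e / r"
    using approx_root_one_plus[OF _ k, of _ "e / r"] e r by auto
  have "(c *\<^sub>R p) ^ n = c ^ n *\<^sub>R p ^ n" for c n
    by (induction n) (simp_all add: mult_ac)
  then have "(root k r *\<^sub>R p) ^ k = r *\<^sub>R p ^ k"
    using r k by simp
  then have "(root k r *\<^sub>R p) ^ k - (r *\<^sub>R 1 + z) = r *\<^sub>R (p ^ k - (1 + (1 / r) *\<^sub>R z))"
    using r by (simp add: algebra_simps)
  then have "\<rho> ((root k r *\<^sub>R p) ^ k - (r *\<^sub>R 1 + z)) = r * \<rho> (p ^ k - (1 + (1 / r) *\<^sub>R z))"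
    using r by (simp only: seminorm_scaleR abs_of_pos)
  also have "\<dots> < e"
    using p r by (simp add: field_simps)
  finally have "\<rho> ((root k r *\<^sub>R p) ^ k - (r *\<^sub>R 1 + z)) < e" .
  then show ?thesis by blast
qed


section \<open>Modules over the balls around positive constants\<close>

text \<open>The third condition says that \<open>M\<close> is stable under multiplication by the elements \<open>r + z\<close> of the open
  balls of radius \<open>r\<close> around the constants \<open>r > 0\<close>. These elements play the role of the
  \<open>k\<close>-th powers. With \<open>z = 0\<close>, the condition makes \<open>M\<close> a convex cone.\<close>

definition ball_module :: "('a \<Rightarrow> real) \<Rightarrow> 'a set \<Rightarrow> bool" where
  "ball_module \<sigma> M \<longleftrightarrow> 1 \<in> M \<and> (\<forall>x\<in>M. \<forall>y\<in>M. x + y \<in> M) \<and>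
     (\<forall>x\<in>M. \<forall>z r. \<sigma> z < r \<longrightarrow> r *\<^sub>R x + z * x \<in> M)"

text \<open>By \<open>approx_root\<close>, multiplication by \<open>r + z\<close> is a limit of multiplications by \<open>k\<close>-th powers, which
  preserve \<open>S\<close>.\<close>

lemma ball_module_closure_of_power_module:
  assumes S: "power_module k S" and k: "0 < k"
  shows "ball_module \<rho> (seminorm_topology \<rho> closure_of S)"
  unfolding ball_module_def in_seminorm_closure_iff
proof (intro conjI ballI allI impI)
  fix e :: real assume "0 < e"
  then show "\<exists>s\<in>S. \<rho> (s - 1) < e"
    using S by (auto simp: power_module_def seminorm_zero intro!: bexI[of _ 1])
next
  fix x y and e :: real
  assume "x \<in> seminorm_topology \<rho> closure_of S" "y \<in> seminorm_topology \<rho> closure_of S" "0 < e"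
  then obtain s t where st: "s \<in> S" "\<rho> (s - x) < e / 2" "t \<in> S" "\<rho> (t - y) < e / 2"
    unfolding in_seminorm_closure_iff by (meson half_gt_zero)
  then have "\<rho> ((s + t) - (x + y)) < e"
    using seminorm_add[of "s - x" "t - y"] by (simp add: algebra_simps)
  then show "\<exists>s\<in>S. \<rho> (s - (x + y)) < e"
    using S st by (auto simp: power_module_def)
next
  fix x z and r e :: real
  assume x: "x \<in> seminorm_topology \<rho> closure_of S" and z: "\<rho> z < r" and e: "0 < e"
  define w where "w = r *\<^sub>R 1 + z"
  obtain s where s: "s \<in> S" "\<rho> (s - x) < e / (2 * (\<rho> w + 1))"
    using x e seminorm_nonneg[of w] unfolding in_seminorm_closure_iff
    by (metis add_nonneg_pos divide_pos_pos mult_pos_pos zero_less_numeral zero_less_one)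
  obtain p where p: "\<rho> (p ^ k - w) < e / (2 * (\<rho> s + 1))"
    using approx_root[OF z k, of "e / (2 * (\<rho> s + 1))"] e seminorm_nonneg[of s] unfolding w_def by auto
  have "\<rho> ((p ^ k - w) * s) \<le> \<rho> (p ^ k - w) * (\<rho> s + 1)"
    using seminorm_mult[of "p ^ k - w" s] seminorm_nonneg[of "p ^ k - w"]
    by (simp add: distrib_left)
  also have "\<dots> < e / 2"
    using p seminorm_nonneg[of s] by (simp add: field_simps)
  finally have 1: "\<rho> ((p ^ k - w) * s) < e / 2" .
  have "\<rho> (w * (s - x)) \<le> (\<rho> w + 1) * \<rho> (s - x)"
    using seminorm_mult[of w "s - x"] seminorm_nonneg[of "s - x"]
    by (simp add: distrib_right)
  also have "\<dots> < e / 2"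
    using s seminorm_nonneg[of w] by (simp add: field_simps)
  finally have "\<rho> ((p ^ k - w) * s) + \<rho> (w * (s - x)) < e"
    using 1 by simp
  with seminorm_add[of "(p ^ k - w) * s" "w * (s - x)"]
  have "\<rho> ((p ^ k - w) * s + w * (s - x)) < e" by linarith
  also have "(p ^ k - w) * s + w * (s - x) = p ^ k * s - (r *\<^sub>R x + z * x)"
    by (simp add: w_def algebra_simps)
  finally have "\<rho> (p ^ k * s - (r *\<^sub>R x + z * x)) < e" .
  then show "\<exists>s\<in>S. \<rho> (s - (r *\<^sub>R x + z * x)) < e"
    using S s(1) by (auto simp: power_module_def)
qed

context
  fixes M :: "'a set"
  assumes M: "ball_module \<rho> M"
begin

lemma ball_module_one: "1 \<in> M"
  and ball_module_add: "x \<in> M \<Longrightarrow> y \<in> M \<Longrightarrow> x + y \<in> M"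
  and ball_module_mult: "x \<in> M \<Longrightarrow> \<rho> z < r \<Longrightarrow> r *\<^sub>R x + z * x \<in> M"
  using M by (auto simp: ball_module_def)

lemma ball_module_scaleR: "x \<in> M \<Longrightarrow> 0 < r \<Longrightarrow> r *\<^sub>R x \<in> M"
  using ball_module_mult[of x 0 r] by (simp add: seminorm_zero)

lemma ball_module_const: "0 < r \<Longrightarrow> r *\<^sub>R 1 \<in> M"
  by (intro ball_module_scaleR ball_module_one)

lemma ball_module_archimedean: "\<rho> x < r \<Longrightarrow> x + r *\<^sub>R 1 \<in> M"
  using ball_module_mult[OF ball_module_one, of x r] by (simp add: add.commute)

lemma ball_module_neg_const:
  assumes "- 1 \<notin> M" "r *\<^sub>R 1 \<in> M"
  shows "0 \<le> r"
proof (rule ccontr)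
  assume "\<not> 0 \<le> r"
  then show False
    using ball_module_scaleR[OF assms(2), of "- (1 / r)"] assms(1) by simp
qed

text \<open>The extension is \<open>M\<close> minus the positive multiples of \<open>x\<close>. This only subtracts scalar multiples
  of \<open>x\<close>, so stability under \<open>r + z\<close> has to be checked: if \<open>y + l * x \<in> M\<close>, then
  \<open>(r + z) * y + l * (r + z) * x \<in> M\<close>, and adding \<open>l * (r - z) * x\<close>, which lies in \<open>M\<close> because
  \<open>\<rho> (- z) < r\<close>, replaces the second term by the scalar multiple \<open>2 * r * l * x\<close>.
  If \<open>- 1\<close> were in the extension, say \<open>- 1 + l * x \<in> M\<close>, then \<open>x - 1 / l\<close> would be in \<open>M\<close>.\<close>

lemma ball_module_extend:
  assumes x: "x \<in> M" and not: "\<And>e. 0 < e \<Longrightarrow> x - e *\<^sub>R 1 \<notin> M"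
  obtains N where "ball_module \<rho> N" "M \<subseteq> N" "- 1 \<notin> N" "- x \<in> N"
proof
  define N where "N = {y. \<exists>l>0. y + l *\<^sub>R x \<in> M}"
  show "ball_module \<rho> N"
    unfolding ball_module_def
  proof (intro conjI ballI allI impI)
    show "1 \<in> N"
      using ball_module_add[OF ball_module_one x] by (auto simp: N_def intro!: exI[of _ 1])
  next
    fix y y' assume "y \<in> N" "y' \<in> N"
    then obtain l l' where "0 < l" "y + l *\<^sub>R x \<in> M" "0 < l'" "y' + l' *\<^sub>R x \<in> M"
      by (auto simp: N_def)
    then show "y + y' \<in> N"
      using ball_module_add[of "y + l *\<^sub>R x" "y' + l' *\<^sub>R x"]
      by (auto simp: N_def algebra_simps intro!: exI[of _ "l + l'"])
  next
    fix y z and r :: real assume "y \<in> N" and z: "\<rho> z < r"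
    then obtain l where l: "0 < l" "y + l *\<^sub>R x \<in> M" by (auto simp: N_def)
    have r: "0 < r"
      using z seminorm_nonneg[of z] by linarith
    have "r *\<^sub>R (y + l *\<^sub>R x) + z * (y + l *\<^sub>R x) \<in> M"
      by (rule ball_module_mult[OF l(2) z])
    moreover have "l *\<^sub>R (r *\<^sub>R x + (- z) * x) \<in> M"
      using z l by (intro ball_module_scaleR ball_module_mult x) (simp_all add: seminorm_minus)
    ultimately have "(r *\<^sub>R (y + l *\<^sub>R x) + z * (y + l *\<^sub>R x)) + l *\<^sub>R (r *\<^sub>R x + (- z) * x) \<in> M"
      by (rule ball_module_add)
    also have "(r *\<^sub>R (y + l *\<^sub>R x) + z * (y + l *\<^sub>R x)) + l *\<^sub>R (r *\<^sub>R x + (- z) * x)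
        = (r *\<^sub>R y + z * y) + (2 * r * l) *\<^sub>R x"
      by (simp add: algebra_simps flip: scaleR_add_left)
    finally show "r *\<^sub>R y + z * y \<in> N"
      using r l by (auto simp: N_def intro!: exI[of _ "2 * r * l"])
  qed
  show "M \<subseteq> N"
    using x by (auto simp: N_def intro!: exI[of _ 1] ball_module_add)
  show "- 1 \<notin> N"
  proof
    assume "- 1 \<in> N"
    then obtain l where l: "0 < l" "- 1 + l *\<^sub>R x \<in> M" by (auto simp: N_def)
    from ball_module_scaleR[OF l(2), of "1 / l"] l(1) have "x - (1 / l) *\<^sub>R 1 \<in> M"
      by (simp add: algebra_simps)
    with not[of "1 / l"] l(1) show False by simp
  qed
  show "- x \<in> N"
    using ball_module_scaleR[OF x, of 1] x by (auto simp: N_def scaleR_2 intro!: exI[of _ 2])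
qed

text \<open>The constant \<open>m\<close> is the supremum of all \<open>r\<close> with \<open>x - r \<in> M\<close>. It exists because \<open>1\<close> is an order unit
  and \<open>- 1 \<notin> M\<close>, and it is attained because \<open>M\<close> is Archimedean closed.\<close>

lemma ball_module_best_const:
  assumes closed: "\<And>x. (\<And>e. 0 < e \<Longrightarrow> x + e *\<^sub>R 1 \<in> M) \<Longrightarrow> x \<in> M"
    and proper: "- 1 \<notin> M"
  obtains m where "x - m *\<^sub>R 1 \<in> M" "\<And>e. 0 < e \<Longrightarrow> x - m *\<^sub>R 1 - e *\<^sub>R 1 \<notin> M"
proof
  define R where "R = {r. x - r *\<^sub>R 1 \<in> M}"
  have ne: "- (\<rho> x + 1) \<in> R"
    using ball_module_archimedean[of x "\<rho> x + 1"] by (simp add: R_def del: minus_add_distrib)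
  have "r \<le> \<rho> x + 1" if "r \<in> R" for r
  proof -
    have "- x + (\<rho> x + 1) *\<^sub>R 1 \<in> M"
      by (intro ball_module_archimedean) (simp add: seminorm_minus)
    from ball_module_add[OF this, of "x - r *\<^sub>R 1"] that
    have "(\<rho> x + 1 - r) *\<^sub>R 1 \<in> M" by (simp add: R_def algebra_simps)
    then show ?thesis using ball_module_neg_const[OF proper] by fastforce
  qed
  then have bdd: "bdd_above R" by (rule bdd_aboveI)
  show "x - Sup R *\<^sub>R 1 \<in> M"
  proof (rule closed)
    fix e :: real assume "0 < e"
    then obtain r where r: "r \<in> R" "Sup R - e < r"
      using less_cSup_iff[OF _ bdd, of "Sup R - e"] ne by auto
    have "(x - r *\<^sub>R 1) + (r - (Sup R - e)) *\<^sub>R 1 \<in> M"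
      using r by (intro ball_module_add ball_module_const) (auto simp: R_def)
    then show "x - Sup R *\<^sub>R 1 + e *\<^sub>R 1 \<in> M" by (simp add: algebra_simps)
  qed
  show "x - Sup R *\<^sub>R 1 - e *\<^sub>R 1 \<notin> M" if "0 < e" for e
  proof
    assume "x - Sup R *\<^sub>R 1 - e *\<^sub>R 1 \<in> M"
    then have "Sup R + e \<in> R" by (simp add: R_def algebra_simps)
    then show False using cSup_upper[OF _ bdd] that by fastforce
  qed
qed

text \<open>Since \<open>- 1\<close> is not created by this closure either, maximal proper modules are Archimedean
  closed.\<close>

lemma ball_module_archimedean_closure:
  "ball_module \<rho> {x. \<forall>e>0. x + e *\<^sub>R 1 \<in> M}" (is "ball_module \<rho> ?N")
  unfolding ball_module_def
proof (intro conjI ballI allI impI)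
  show "1 \<in> ?N"
    by (auto intro: ball_module_add ball_module_one ball_module_const)
next
  fix x y assume xy: "x \<in> ?N" "y \<in> ?N"
  have "x + y + e *\<^sub>R 1 \<in> M" if "0 < e" for e :: real
    using ball_module_add[of "x + (e / 2) *\<^sub>R 1" "y + (e / 2) *\<^sub>R 1"] xy that
    by (simp add: algebra_simps flip: scaleR_add_left)
  then show "x + y \<in> ?N" by simp
next
  fix x z and r :: real assume x: "x \<in> ?N" and z: "\<rho> z < r"
  have r: "0 < r"
    using z seminorm_nonneg[of z] by linarith
  have "r *\<^sub>R x + z * x + e *\<^sub>R 1 \<in> M" if "0 < e" for e :: real
  proof -
    \<comment> \<open>The product (r + z) (x + d) exceeds (r + z) x by d r + d z; adding d (r - z) cancels the term in z.\<close>
    define d where "d = e / (2 * r)"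
    have d: "0 < d" using r that by (simp add: d_def)
    have e: "e *\<^sub>R (1 :: 'a) = (d * r) *\<^sub>R 1 + (d * r) *\<^sub>R 1"
      using r by (simp add: d_def flip: scaleR_add_left)
    have "r *\<^sub>R (x + d *\<^sub>R 1) + z * (x + d *\<^sub>R 1) \<in> M"
      using x d z by (intro ball_module_mult) auto
    moreover have "d *\<^sub>R (- z + r *\<^sub>R 1) \<in> M"
      using d z by (intro ball_module_scaleR ball_module_archimedean) (simp_all add: seminorm_minus)
    ultimately have "(r *\<^sub>R (x + d *\<^sub>R 1) + z * (x + d *\<^sub>R 1)) + d *\<^sub>R (- z + r *\<^sub>R 1) \<in> M"
      by (rule ball_module_add)
    also have "(r *\<^sub>R (x + d *\<^sub>R 1) + z * (x + d *\<^sub>R 1)) + d *\<^sub>R (- z + r *\<^sub>R 1)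
        = r *\<^sub>R x + z * x + e *\<^sub>R 1"
      by (simp add: e algebra_simps)
    finally show ?thesis .
  qed
  then show "r *\<^sub>R x + z * x \<in> ?N" by simp
qed

end

section \<open>Maximal proper modules and characters\<close>

lemma maximal_ball_module_exists:
  assumes C: "ball_module \<rho> C" "- 1 \<notin> C"
  obtains M where "ball_module \<rho> M" "C \<subseteq> M" "- 1 \<notin> M"
    "\<And>N. ball_module \<rho> N \<Longrightarrow> M \<subseteq> N \<Longrightarrow> - 1 \<notin> N \<Longrightarrow> N = M"
proof -
  let ?A = "{N. ball_module \<rho> N \<and> C \<subseteq> N \<and> - 1 \<notin> N}"
  have "\<exists>M\<in>?A. \<forall>N\<in>?A. M \<subseteq> N \<longrightarrow> N = M"
  proof (rule subset_Zorn_nonempty)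
    show "?A \<noteq> {}" using C by auto
  next
    fix \<C> assume ne: "\<C> \<noteq> {}" and ch: "subset.chain ?A \<C>"
    then have in_A: "N \<in> ?A" if "N \<in> \<C>" for N
      using that by (auto simp: subset_chain_def)
    have "ball_module \<rho> (\<Union>\<C>)"
      unfolding ball_module_def
    proof (intro conjI ballI allI impI)
      show "1 \<in> \<Union>\<C>" using ne in_A by (auto simp: ball_module_def)
    next
      fix x y assume "x \<in> \<Union>\<C>" "y \<in> \<Union>\<C>"
      then obtain N where "N \<in> \<C>" "x \<in> N" "y \<in> N"
        using ch unfolding subset_chain_def by blast
      moreover from this(1) have "ball_module \<rho> N" using in_A by blast
      ultimately show "x + y \<in> \<Union>\<C>" by (auto simp: ball_module_def)
    next
      fix x z and r :: real assume "x \<in> \<Union>\<C>" "\<rho> z < r"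
      then show "r *\<^sub>R x + z * x \<in> \<Union>\<C>" using in_A by (fastforce simp: ball_module_def)
    qed
    then show "\<Union>\<C> \<in> ?A" using ne in_A by auto
  qed
  then obtain M where M: "M \<in> ?A" "\<forall>N\<in>?A. M \<subseteq> N \<longrightarrow> N = M" by blast
  show ?thesis
    using M by (intro that[of M]) auto
qed

text \<open>Both \<open>ball_module_archimedean_closure\<close> and \<open>ball_module_extend\<close> produce proper modules containing
  \<open>M\<close>, which by maximality equal \<open>M\<close>.\<close>

lemma maximal_ball_module_split:
  assumes M: "ball_module \<rho> M" "- 1 \<notin> M"
    and max: "\<And>N. ball_module \<rho> N \<Longrightarrow> M \<subseteq> N \<Longrightarrow> - 1 \<notin> N \<Longrightarrow> N = M"
  shows "\<exists>m. x - m *\<^sub>R 1 \<in> M \<and> m *\<^sub>R 1 - x \<in> M"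
proof -
  let ?N = "{x. \<forall>e>0. x + e *\<^sub>R 1 \<in> M}"
  have "?N = M"
  proof (rule max)
    show "M \<subseteq> ?N"
      by (auto intro: ball_module_add[OF M(1)] ball_module_const[OF M(1)])
    have "- 1 + (1 / 2) *\<^sub>R 1 = (- 1 / 2) *\<^sub>R (1 :: 'a)"
      using scaleR_add_left[of "-1" "1 / 2" "1 :: 'a"] by simp
    then show "- 1 \<notin> ?N"
      using ball_module_neg_const[OF M, of "- 1 / 2"] by (auto intro!: exI[of _ "1 / 2"])
  qed (rule ball_module_archimedean_closure[OF M(1)])
  then have closed: "x \<in> M" if "\<And>e. 0 < e \<Longrightarrow> x + e *\<^sub>R 1 \<in> M" for x
    using that by blast
  obtain m where m: "x - m *\<^sub>R 1 \<in> M" "\<And>e. 0 < e \<Longrightarrow> x - m *\<^sub>R 1 - e *\<^sub>R 1 \<notin> M"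
    using ball_module_best_const[OF M(1) closed M(2), of x] by blast
  obtain N where "ball_module \<rho> N" "M \<subseteq> N" "- 1 \<notin> N" "- (x - m *\<^sub>R 1) \<in> N"
    using ball_module_extend[OF M(1) m] by blast
  with max m(1) show ?thesis by (intro exI[of _ m]) auto
qed

text \<open>The map \<open>\<alpha>\<close> is the quotient map modulo \<open>I = M \<inter> - M\<close>, whose cosets are represented by unique
  constants. It satisfies \<open>\<bar>\<alpha> x\<bar> \<le> \<rho> x\<close>, and hence is continuous, because \<open>x + r\<close> and \<open>- x + r\<close> are in \<open>M\<close>
  for \<open>r > \<rho> x\<close>. The last conclusion transfers a prescribed value from a smaller module: it
  applies as soon as both differences are known to be in \<open>M\<close>.\<close>

lemma character_of_maximal_ball_module:
  assumes M: "ball_module \<rho> M" "- 1 \<notin> M"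
    and max: "\<And>N. ball_module \<rho> N \<Longrightarrow> M \<subseteq> N \<Longrightarrow> - 1 \<notin> N \<Longrightarrow> N = M"
  obtains \<alpha> where "\<alpha> \<in> gelfand_spectrum \<rho>" "\<And>x. x \<in> M \<Longrightarrow> 0 \<le> \<alpha> x"
    "\<And>x m. x - m *\<^sub>R 1 \<in> M \<Longrightarrow> m *\<^sub>R 1 - x \<in> M \<Longrightarrow> \<alpha> x = m"
proof -
  note add = ball_module_add[OF M(1)] and scale = ball_module_scaleR[OF M(1)]
  define I where "I = {x. x \<in> M \<and> - x \<in> M}"
  have split: "\<exists>m. x - m *\<^sub>R 1 \<in> I" for x
    using maximal_ball_module_split[OF M max, of x] by (auto simp: I_def)
  have I_add: "x + y \<in> I" if "x \<in> I" "y \<in> I" for x y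
    using that add[of x y] add[of "- x" "- y"] by (simp add: I_def)
  have I_minus: "- x \<in> I" if "x \<in> I" for x
    using that by (simp add: I_def)
  have I_0: "0 \<in> I"
    using split[of 0] I_add I_minus by (metis add.right_inverse)
  have I_pos: "r *\<^sub>R x \<in> I" if "0 < r" "x \<in> I" for r x
    using that scale[of x r] scale[of "- x" r] by (simp add: I_def)
  have I_scale: "r *\<^sub>R x \<in> I" if "x \<in> I" for r x
    using that I_0 I_pos[of r x] I_pos[of "- r" "- x"] I_minus[of x] by (cases r "0 :: real" rule: linorder_cases) auto
  have I_mult: "y * x \<in> I" if "x \<in> I" for x y
  proof -
    (* A multiplier y becomes admissible after adding a constant above \<rho> y. *)
    define r where "r = \<rho> y + 1"
    have "r *\<^sub>R x + y * x \<in> M" "r *\<^sub>R (- x) + y * (- x) \<in> M"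
      using that by (auto simp: I_def r_def intro!: ball_module_mult[OF M(1)] simp del: mult_minus_right scaleR_minus_right)
    then have "r *\<^sub>R x + y * x \<in> I" by (simp add: I_def)
    from I_add[OF this I_minus[OF I_scale[OF that, of r]]] show ?thesis by simp
  qed
  have uniq: "r = s" if "x - r *\<^sub>R 1 \<in> I" "x - s *\<^sub>R 1 \<in> I" for x r s
  proof -
    have "(x - r *\<^sub>R 1) + - (x - s *\<^sub>R 1) \<in> I"
      by (intro I_add I_minus that)
    also have "(x - r *\<^sub>R 1) + - (x - s *\<^sub>R 1) = (s - r) *\<^sub>R 1"
      by (simp add: algebra_simps)
    finally have "(s - r) *\<^sub>R 1 \<in> M" "(r - s) *\<^sub>R 1 \<in> M"
      by (auto simp: I_def algebra_simps)
    then show ?thesis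
      using ball_module_neg_const[OF M, of "s - r"] ball_module_neg_const[OF M, of "r - s"] by simp
  qed
  define \<alpha> where "\<alpha> x = (THE m. x - m *\<^sub>R 1 \<in> I)" for x
  have \<alpha>_eqI: "\<alpha> x = m" if "x - m *\<^sub>R 1 \<in> I" for x m
    unfolding \<alpha>_def using that uniq by blast
  have \<alpha>: "x - \<alpha> x *\<^sub>R 1 \<in> I" for x
    using split[of x] \<alpha>_eqI by metis
  have "linear \<alpha>"
  proof (rule linearI)
    fix x y
    show "\<alpha> (x + y) = \<alpha> x + \<alpha> y"
      using I_add[OF \<alpha>[of x] \<alpha>[of y]] by (intro \<alpha>_eqI) (simp add: algebra_simps)
  next
    fix r x
    show "\<alpha> (r *\<^sub>R x) = r *\<^sub>R \<alpha> x"
      using I_scale[OF \<alpha>[of x], of r] by (intro \<alpha>_eqI) (simp add: algebra_simps)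
  qed
  have mult: "\<alpha> (x * y) = \<alpha> x * \<alpha> y" for x y
  proof (rule \<alpha>_eqI)
    have "x * y - (\<alpha> x * \<alpha> y) *\<^sub>R 1 = y * (x - \<alpha> x *\<^sub>R 1) + \<alpha> x *\<^sub>R (y - \<alpha> y *\<^sub>R 1)"
      by (simp add: algebra_simps)
    then show "x * y - (\<alpha> x * \<alpha> y) *\<^sub>R 1 \<in> I"
      using \<alpha> by (simp only: I_add I_mult I_scale)
  qed
  have "\<alpha> 1 = 1"
    using I_0 by (intro \<alpha>_eqI) simp
  have nonneg: "0 \<le> \<alpha> x" if "x \<in> M" for x
  proof -
    have "x + - (x - \<alpha> x *\<^sub>R 1) \<in> M"
      using that \<alpha>[of x] by (intro add) (auto simp: I_def)
    then show ?thesis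
      using ball_module_neg_const[OF M, of "\<alpha> x"] by simp
  qed
  have lower: "- \<rho> x \<le> \<alpha> x" for x
  proof (rule field_le_epsilon)
    fix e :: real assume "0 < e"
    then have "0 \<le> \<alpha> (x + (\<rho> x + e) *\<^sub>R 1)"
      by (intro nonneg ball_module_archimedean[OF M(1)]) simp
    then show "- \<rho> x \<le> \<alpha> x + e"
      using \<open>linear \<alpha>\<close> \<open>\<alpha> 1 = 1\<close> by (simp add: linear_add linear_scale)
  qed
  have "\<bar>\<alpha> x\<bar> \<le> \<rho> x" for x
    using lower[of x] lower[of "- x"] \<open>linear \<alpha>\<close>
    by (simp add: linear_neg seminorm_minus)
  then have "\<alpha> \<in> gelfand_spectrum \<rho>"
    using \<open>linear \<alpha>\<close> \<open>\<alpha> 1 = 1\<close> mult continuous_map_if_bounded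
    by (auto simp: gelfand_spectrum_def characters_def)
  then show ?thesis
    using nonneg \<alpha>_eqI by (intro that[of \<alpha>]) (auto simp: I_def)
qed

text \<open>Adjoining \<open>m - a\<close> to \<open>C\<close> first ensures that every maximal module above it assigns \<open>m < 0\<close> to \<open>a\<close>.
  An arbitrary maximal module above \<open>C\<close> may give \<open>a\<close> a nonnegative value.\<close>

lemma separating_character:
  assumes C: "ball_module \<rho> C" and closed: "\<And>x. (\<And>e. 0 < e \<Longrightarrow> x + e *\<^sub>R 1 \<in> C) \<Longrightarrow> x \<in> C"
    and a: "a \<notin> C"
  obtains \<alpha> where "\<alpha> \<in> gelfand_spectrum \<rho>" "\<And>x. x \<in> C \<Longrightarrow> 0 \<le> \<alpha> x" "\<alpha> a < 0"
proof -
  have proper: "- 1 \<notin> C"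
  proof
    assume "- 1 \<in> C"
    (* Then C is everything, as 1 is an order unit. *)
    then have "(\<rho> a + 1) *\<^sub>R (- 1) \<in> C"
      using seminorm_nonneg[of a]
      by (intro ball_module_scaleR[OF C]) auto
    from ball_module_add[OF C this ball_module_archimedean[OF C, of a "\<rho> a + 1"]] a
    show False by simp
  qed
  obtain m where m: "a - m *\<^sub>R 1 \<in> C" "\<And>e. 0 < e \<Longrightarrow> a - m *\<^sub>R 1 - e *\<^sub>R 1 \<notin> C"
    using ball_module_best_const[OF C closed proper, of a] by blast
  have "m < 0"
  proof (rule ccontr)
    assume "\<not> m < 0"
    have "a + e *\<^sub>R 1 \<in> C" if "0 < e" for e
      using ball_module_add[OF C m(1) ball_module_const[OF C, of "m + e"]] that \<open>\<not> m < 0\<close>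
      by (simp add: scaleR_add_left)
    with a closed show False by blast
  qed
  obtain N where N: "ball_module \<rho> N" "C \<subseteq> N" "- 1 \<notin> N" "- (a - m *\<^sub>R 1) \<in> N"
    using ball_module_extend[OF C m] by blast
  obtain M where M: "ball_module \<rho> M" "N \<subseteq> M" "- 1 \<notin> M"
    "\<And>N. ball_module \<rho> N \<Longrightarrow> M \<subseteq> N \<Longrightarrow> - 1 \<notin> N \<Longrightarrow> N = M"
    using maximal_ball_module_exists[OF N(1,3)] by blast
  obtain \<alpha> where \<alpha>: "\<alpha> \<in> gelfand_spectrum \<rho>" "\<And>x. x \<in> M \<Longrightarrow> 0 \<le> \<alpha> x"
    "\<And>x m. x - m *\<^sub>R 1 \<in> M \<Longrightarrow> m *\<^sub>R 1 - x \<in> M \<Longrightarrow> \<alpha> x = m"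
    using character_of_maximal_ball_module[OF M(1,3,4)] by blast
  have "a - m *\<^sub>R 1 \<in> M" "m *\<^sub>R 1 - a \<in> M"
    using m(1) N(2,4) M(2) by auto
  then have "\<alpha> a < 0" using \<alpha>(3) \<open>m < 0\<close> by simp
  then show ?thesis
    using \<alpha>(1,2) N(2) M(2) by (intro that[of \<alpha>]) auto
qed

section \<open>The closure of a power module\<close>

text \<open>For the inclusion from right to left, \<open>separating_character\<close> needs the topological closure to be
  Archimedean closed, which holds since \<open>\<rho> (e *\<^sub>R 1)\<close> tends to \<open>0\<close> with \<open>e\<close>.\<close>

lemma closure_of_power_module:
  assumes S: "power_module k S" and k: "0 < k"
  shows "seminorm_topology \<rho> closure_of S = Pos (nonneg_characters S \<inter> gelfand_spectrum \<rho>)"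
proof
  show "seminorm_topology \<rho> closure_of S \<subseteq> Pos (nonneg_characters S \<inter> gelfand_spectrum \<rho>)"
  proof
    fix a assume a: "a \<in> seminorm_topology \<rho> closure_of S"
    have "0 \<le> \<alpha> a" if \<alpha>: "\<alpha> \<in> nonneg_characters S" "\<alpha> \<in> gelfand_spectrum \<rho>" for \<alpha>
    proof -
      have "closedin (seminorm_topology \<rho>) {x \<in> topspace (seminorm_topology \<rho>). \<alpha> x \<in> {0..}}"
        using \<alpha>(2) by (intro closedin_continuous_map_preimage) (auto simp: gelfand_spectrum_def)
      moreover have "S \<subseteq> {x \<in> topspace (seminorm_topology \<rho>). \<alpha> x \<in> {0..}}"
        using \<alpha>(1) by (auto simp: nonneg_characters_def topspace_seminorm_topology)
      ultimately have "seminorm_topology \<rho> closure_of S \<subseteq> {x \<in> topspace (seminorm_topology \<rho>). \<alpha> x \<in> {0..}}"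
        by (intro closure_of_minimal)
      with a show ?thesis by auto
    qed
    then show "a \<in> Pos (nonneg_characters S \<inter> gelfand_spectrum \<rho>)"
      by (simp add: Pos_def)
  qed
next
  let ?C = "seminorm_topology \<rho> closure_of S"
  have closed: "x \<in> ?C" if x: "\<And>e. 0 < e \<Longrightarrow> x + e *\<^sub>R 1 \<in> ?C" for x
    unfolding in_seminorm_closure_iff
  proof (intro allI impI)
    fix e :: real assume e: "0 < e"
    define d where "d = e / (2 * (\<rho> 1 + 1))"
    have d: "0 < d" using e seminorm_nonneg[of 1] by (simp add: d_def)
    obtain s where s: "s \<in> S" "\<rho> (s - (x + d *\<^sub>R 1)) < e / 2"
      using x[OF d] e unfolding in_seminorm_closure_iff by (meson half_gt_zero)
    have "\<rho> (d *\<^sub>R 1) \<le> d * (\<rho> 1 + 1)"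
      using d by (simp add: seminorm_scaleR)
    also have "\<dots> = e / 2"
      using seminorm_nonneg[of 1] by (simp add: d_def field_simps)
    finally have "\<rho> (s - x) < e"
      using seminorm_add[of "s - (x + d *\<^sub>R 1)" "d *\<^sub>R 1"] s(2) by simp
    with s(1) show "\<exists>s\<in>S. \<rho> (s - x) < e" by blast
  qed
  have "S \<subseteq> ?C"
    by (rule closure_of_subset) (simp add: topspace_seminorm_topology)
  show "Pos (nonneg_characters S \<inter> gelfand_spectrum \<rho>) \<subseteq> ?C"
  proof (rule subsetI, rule ccontr)
    fix a assume a: "a \<in> Pos (nonneg_characters S \<inter> gelfand_spectrum \<rho>)" and "a \<notin> ?C"
    then obtain \<alpha> where \<alpha>: "\<alpha> \<in> gelfand_spectrum \<rho>" "\<And>x. x \<in> ?C \<Longrightarrow> 0 \<le> \<alpha> x" "\<alpha> a < 0"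
      using separating_character[OF ball_module_closure_of_power_module[OF S k] closed] by blast
    then have "\<alpha> \<in> nonneg_characters S"
      using \<open>S \<subseteq> ?C\<close> by (auto simp: nonneg_characters_def gelfand_spectrum_def)
    with a \<alpha> show False by (force simp: Pos_def)
  qed
qed

end

lemma power_module_sums_of_powers:
  "power_module k (sums_of_powers k :: 'a::{real_algebra, comm_ring, comm_monoid_mult} set)"
  unfolding power_module_def
proof (intro conjI ballI allI)
  show "(1 :: 'a) \<in> sums_of_powers k"
    by (auto simp: sums_of_powers_def intro!: exI[of _ "1 :: nat"] exI[of _ "\<lambda>_. 1"])
next
  fix x y :: 'a assume "x \<in> sums_of_powers k" "y \<in> sums_of_powers k"
  then obtain n a m b where x: "x = (\<Sum>i<(n :: nat). a i ^ k)" and y: "y = (\<Sum>i<(m :: nat). b i ^ k)"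
    by (auto simp: sums_of_powers_def)
  define c where "c i = (if i < n then a i else b (i - n))" for i
  have "(\<Sum>i<n + m. c i ^ k) = (\<Sum>i<n. c i ^ k) + (\<Sum>i<m. c (i + n) ^ k)"
    by (induction m) (simp_all add: ac_simps)
  then have "x + y = (\<Sum>i<n + m. c i ^ k)"
    by (simp add: x y c_def)
  then show "x + y \<in> sums_of_powers k"
    unfolding sums_of_powers_def by blast
next
  fix a x :: 'a assume "x \<in> sums_of_powers k"
  then obtain n b where "x = (\<Sum>i<(n :: nat). b i ^ k)"
    by (auto simp: sums_of_powers_def)
  then have "a ^ k * x = (\<Sum>i<n. (a * b i) ^ k)"
    by (simp add: sum_distrib_left power_mult_distrib)
  then show "a ^ k * x \<in> sums_of_powers k"
    by (auto simp: sums_of_powers_def intro!: exI[of _ n] exI[of _ "\<lambda>i. a * b i"])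
qed

lemma nonneg_characters_sums_of_even_powers:
  assumes "even k"
  shows "nonneg_characters (sums_of_powers k) = characters"
proof -
  have "0 \<le> \<alpha> (\<Sum>i<n. a i ^ k)" if "\<alpha> \<in> characters" for \<alpha> :: "'a \<Rightarrow> real" and n :: nat and a
  proof -
    have "\<alpha> (x ^ n) = \<alpha> x ^ n" for x n
      using that by (induction n) (auto simp: characters_def)
    moreover have "\<alpha> (\<Sum>i<n. a i ^ k) = (\<Sum>i<n. \<alpha> (a i ^ k))"
      using that by (simp add: characters_def linear_sum)
    ultimately show ?thesis
      using assms by (simp add: sum_nonneg zero_le_even_power)
  qed
  then show ?thesis
    by (auto simp: nonneg_characters_def sums_of_powers_def)
qed

theorem theorem3p7:
  fixes \<rho> :: "'a::{real_algebra, comm_ring, comm_monoid_mult} \<Rightarrow> real"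
    and d :: nat
  assumes "submultiplicative_seminorm \<rho>"
    and "1 \<le> d"
  shows "(\<forall>S :: 'a set. power_module (2 * d) S \<longrightarrow>
            seminorm_topology \<rho> closure_of S = Pos (nonneg_characters S \<inter> gelfand_spectrum \<rho>)) \<and>
         seminorm_topology \<rho> closure_of (sums_of_powers (2 * d)) = Pos (gelfand_spectrum \<rho>)"
proof
  have "0 < 2 * d" using assms(2) by simp
  then show *: "\<forall>S :: 'a set. power_module (2 * d) S \<longrightarrow>
      seminorm_topology \<rho> closure_of S = Pos (nonneg_characters S \<inter> gelfand_spectrum \<rho>)"
    using closure_of_power_module[OF assms(1)] by blast
  have "nonneg_characters (sums_of_powers (2 * d)) \<inter> gelfand_spectrum \<rho> = gelfand_spectrum \<rho>"
    by (auto simp: nonneg_characters_sums_of_even_powers gelfand_spectrum_def)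
  then show "seminorm_topology \<rho> closure_of (sums_of_powers (2 * d)) = Pos (gelfand_spectrum \<rho>)"
    using *[rule_format, OF power_module_sums_of_powers] by simp
qed

end
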